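(* Let $h\colon (0,\infty)\to(0,\infty)$ be a nonconstant function. Let $(X,\|\cdot\|_X)$ be a rearrangement-invariant space over $([0,\infty),\lambda)$ such that the norm $\|\cdot\|_X$ is $h$-homogeneous, i.e. $\|D_rf\|_X = h(r)\|f\|_X$ for every $f\in X$ and every $r>0$. Then there exists $p\in[1,\infty)$ such that $h(r)=r^{-\frac1p}$ for all $r>0$.
   Context: $\lambda$ is Lebesgue measure on $[0,\infty)$ and $\mathfrak M([0,\infty))$ is the set of real-valued Lebesgue-measurable functions on $[0,\infty)$ (a.e. equal functions are identified). For $f\in\mathfrak M([0,\infty))$ and $t>0$, $f^*(t)=\inf\{s>0: \lambda(\{x:|f(x)|>s\})\le t\}$. A mapping $\|\cdot\|:\mathfrak M([0,\infty))\to[0,\infty]$ is a rearrangement-invariant (r.i.) norm if for all $f,g,f_n\in\mathfrak M([0,\infty))$ ($n\in\mathbb N$), all $a\in\mathbb R$ and all measurable $E\subset[0,\infty)$: (P1) $\|f+g\|\le\|f\|+\|g\|$, $\|af\|=|a|\|f\|$, and $\|f\|=0\Leftrightarrow f=0$ a.e.; (P2) $0\le g\le f$ a.e. implies $\|g\|\le\|f\|$; (P3) $0\le f_n\uparrow f$ a.e. implies $\|f_n\|\uparrow\|f\|$; (P4) $\lambda(E)<\infty$ implies $\|\chi_E\|<\infty$; (P5) if $\lambda(E)<\infty$ there is $C_E\in(0,\infty)$ depending only on $E$ (and the norm) with $\int_E f\,\mathrm d\lambda\le C_E\|f\|$ for all $f\ge0$; (P6) $f^*=g^*$ implies $\|f\|=\|g\|$.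 The r.i. space generated by an r.i. norm $\|\cdot\|_X$ is $X=\{f\in\mathfrak M([0,\infty)):\|f\|_X<\infty\}$. For $r>0$ the dilation operator is $D_rf(t)=f(rt)$. *)

theory Defs
  imports "HOL-Analysis.Analysis"
begin

text \<open>
  A function on \<open>[0,\<infinity>)\<close> is represented by a function \<open>real \<Rightarrow> real\<close> that is measurable for the
  measure below; its values at negative arguments are irrelevant, since that measure lives on
  \<open>{0..}\<close>.
\<close>

abbreviation lebesgue_halfline :: "real measure" where
  "lebesgue_halfline \<equiv> lebesgue_on {0..}"

text \<open>
  The values are in \<^typ>\<open>ennreal\<close> because the infimum may range over the empty set (for instance for
  \<open>f = (\<lambda>x. x)\<close>); it is then \<open>\<infinity>\<close>.
\<close>

definition decreasing_rearrangement :: "(real \<Rightarrow> real) \<Rightarrow> real \<Rightarrow> ennreal" where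
  "decreasing_rearrangement f t =
     Inf (ennreal ` {s. s > 0 \<and>
       emeasure lebesgue_halfline {x \<in> {0..}. \<bar>f x\<bar> > s} \<le> ennreal t})"

text \<open>
  Only the values of the norm on measurable functions are constrained. That it does not
  distinguish a.e. equal functions is a consequence of subadditivity and definiteness. In
  \<open>homogeneous\<close> the product \<open>0 * \<infinity>\<close> is \<open>0\<close>.
\<close>

locale ri_norm =
  fixes N :: "(real \<Rightarrow> real) \<Rightarrow> ennreal"
  assumes subadditive:
      "\<And>f g. f \<in> borel_measurable lebesgue_halfline \<Longrightarrow> g \<in> borel_measurable lebesgue_halfline \<Longrightarrow>
        N (\<lambda>x. f x + g x) \<le> N f + N g"
    and homogeneous:
      "\<And>f a. f \<in> borel_measurable lebesgue_halfline \<Longrightarrow> N (\<lambda>x. a * f x) = ennreal \<bar>a\<bar> * N f"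
    and definite:
      "\<And>f. f \<in> borel_measurable lebesgue_halfline \<Longrightarrow>
        N f = 0 \<longleftrightarrow> (AE x in lebesgue_halfline. f x = 0)"
    and lattice:
      "\<And>f g. f \<in> borel_measurable lebesgue_halfline \<Longrightarrow> g \<in> borel_measurable lebesgue_halfline \<Longrightarrow>
        (AE x in lebesgue_halfline. 0 \<le> g x \<and> g x \<le> f x) \<Longrightarrow> N g \<le> N f"
    and fatou:
      "\<And>f F. f \<in> borel_measurable lebesgue_halfline \<Longrightarrow>
        (\<And>n::nat. F n \<in> borel_measurable lebesgue_halfline) \<Longrightarrow>
        (AE x in lebesgue_halfline.
           (\<forall>n. 0 \<le> F n x) \<and> incseq (\<lambda>n. F n x) \<and> (\<lambda>n. F n x) \<longlonglongrightarrow> f x) \<Longrightarrow>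
        incseq (\<lambda>n. N (F n)) \<and> (\<lambda>n. N (F n)) \<longlonglongrightarrow> N f"
    and indicator_finite:
      "\<And>E. E \<in> sets lebesgue_halfline \<Longrightarrow> emeasure lebesgue_halfline E < \<infinity> \<Longrightarrow>
        N (indicator E) < \<infinity>"
    and locally_integrable:
      "\<And>E. E \<in> sets lebesgue_halfline \<Longrightarrow> emeasure lebesgue_halfline E < \<infinity> \<Longrightarrow>
        \<exists>C::real. C > 0 \<and>
          (\<forall>f \<in> borel_measurable lebesgue_halfline.
             (AE x in lebesgue_halfline. 0 \<le> f x) \<longrightarrow>
             (\<integral>\<^sup>+ x \<in> E. ennreal (f x) \<partial>lebesgue_halfline) \<le> ennreal C * N f)"
    and rearrangement_invariant:
      "\<And>f g. f \<in> borel_measurable lebesgue_halfline \<Longrightarrow> g \<in> borel_measurable lebesgue_halfline \<Longrightarrow>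
        (\<forall>t>0. decreasing_rearrangement f t = decreasing_rearrangement g t) \<Longrightarrow> N f = N g"

definition ri_space :: "((real \<Rightarrow> real) \<Rightarrow> ennreal) \<Rightarrow> (real \<Rightarrow> real) set" where
  "ri_space N = {f \<in> borel_measurable lebesgue_halfline. N f < \<infinity>}"

definition dilation :: "real \<Rightarrow> (real \<Rightarrow> real) \<Rightarrow> real \<Rightarrow> real" where
  "dilation r f = (\<lambda>t. f (r * t))"

definition h_homogeneous :: "(real \<Rightarrow> real) \<Rightarrow> ((real \<Rightarrow> real) \<Rightarrow> ennreal) \<Rightarrow> bool" where
  "h_homogeneous h N \<longleftrightarrow>
     (\<forall>f \<in> ri_space N. \<forall>r>0. N (dilation r f) = ennreal (h r) * N f)"

end

theory Submission
  imports Defs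
begin

text \<open>
  Everything is read off from the fundamental function \<open>t \<mapsto> N (indicator {0..t})\<close>. Dilating
  \<open>indicator {0..t}\<close> by \<open>r\<close> gives \<open>indicator {0..t / r}\<close>, so homogeneity turns the fundamental
  function into \<open>t \<mapsto> h (1 / t) * c\<close>, where \<open>c\<close>, the norm of the indicator of the unit interval,
  is positive and finite. Three properties of \<open>h\<close> follow:

  \<^item> \<open>h\<close> is multiplicative, because dilating by \<open>r\<close> and then by \<open>s\<close> is dilating by \<open>r * s\<close>
    (\<open>homogeneity_multiplicative\<close>);
  \<^item> \<open>h\<close> is antitone, because the fundamental function is monotone (\<open>homogeneity_antitone\<close>);
  \<^item> \<open>h (1 / 2) \<le> 2\<close>, because an interval of length \<open>2\<close> splits into two intervals of length \<open>1\<close>,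
    whose indicators have equal norms by rearrangement invariance, and the triangle inequality
    applies (\<open>homogeneity_half_le\<close>).

  In logarithmic coordinates the first two properties say that \<open>x \<mapsto> ln (h (exp x))\<close> is an
  antitone solution of Cauchy's functional equation, hence linear, so that \<open>h r = r powr a\<close> for
  some \<open>a\<close>. Antitonicity gives \<open>a \<le> 0\<close>, nonconstancy excludes \<open>a = 0\<close>, and the bound at \<open>1 / 2\<close>
  gives \<open>-1 \<le> a\<close>; hence \<open>p = -1 / a\<close> lies in \<open>[1,\<infinity>)\<close>.
\<close>

text \<open>
  The deviation \<open>D x = L x - x * L 1\<close> is additive and vanishes at \<open>1\<close>, so it has period \<open>1\<close>; it is
  bounded on \<open>[0,1]\<close> by monotonicity, hence everywhere. An additive function that is bounded on
  all multiples of \<open>x\<close> vanishes at \<open>x\<close>.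
\<close>

lemma antimono_additive_linear:
  fixes L :: "real \<Rightarrow> real"
  assumes add: "\<And>x y. L (x + y) = L x + L y" and anti: "antimono L"
  shows "L x = x * L 1"
proof -
  define D where "D x = L x - x * L 1" for x
  have D_add: "D (x + y) = D x + D y" for x y
    by (simp add: D_def add algebra_simps)
  have D_mult: "D (real n * x) = real n * D x" for n x
  proof (induction n)
    case 0
    show ?case using D_add[of 0 0] by simp
  next
    case (Suc n)
    then show ?case using D_add[of "real n * x" x] by (simp add: algebra_simps)
  qed
  have D_1: "D 1 = 0" by (simp add: D_def)
  have D_nat: "D (real n) = 0" for n using D_mult[of n 1] D_1 by simp
  have D_int: "D (of_int k) = 0" for k
  proof (cases k rule: int_cases2)
    case (nonneg n) then show ?thesis using D_nat by simp
  next
    case (nonpos n)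
    then show ?thesis using D_add[of "real n" "- real n"] D_nat[of n] D_nat[of 0] by simp
  qed
  have D_bound: "\<bar>D y\<bar> \<le> 2 * \<bar>L 1\<bar>" for y
  proof -
    have "D y = D (frac y)"
      using D_add[of "of_int \<lfloor>y\<rfloor>" "frac y"] D_int by (simp add: frac_def)
    moreover have "0 \<le> frac y" "frac y \<le> 1"
      using frac_lt_1[of y] by simp_all
    moreover have "L 0 = 0" using add[of 0 0] by simp
    moreover have "\<bar>frac y * L 1\<bar> \<le> \<bar>L 1\<bar>"
      using frac_lt_1[of y] by (simp add: abs_mult mult_left_le_one_le)
    ultimately show ?thesis
      using antimonoD[OF anti, of "frac y" 1] antimonoD[OF anti, of 0 "frac y"]
      by (simp add: D_def)
  qed
  have "D x = 0"
  proof (rule ccontr)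
    assume "D x \<noteq> 0"
    then obtain n where "2 * \<bar>L 1\<bar> < real n * \<bar>D x\<bar>"
      using reals_Archimedean3[of "\<bar>D x\<bar>"] by auto
    then show False using D_bound[of "real n * x"] by (simp add: D_mult abs_mult)
  qed
  then show ?thesis by (simp add: D_def)
qed

lemma antitone_multiplicative_powr:
  fixes h :: "real \<Rightarrow> real"
  assumes pos: "\<And>r. r > 0 \<Longrightarrow> h r > 0"
    and mult: "\<And>r s. r > 0 \<Longrightarrow> s > 0 \<Longrightarrow> h (r * s) = h r * h s"
    and anti: "\<And>r s. 0 < r \<Longrightarrow> r \<le> s \<Longrightarrow> h s \<le> h r"
  shows "\<exists>a. \<forall>r>0. h r = r powr a"
proof -
  define L where "L x = ln (h (exp x))" for x
  have "L (x + y) = L x + L y" for x y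
    using pos[of "exp x"] pos[of "exp y"] by (simp add: L_def exp_add mult ln_mult)
  moreover have "antimono L"
    by (intro antimonoI) (simp add: L_def pos anti)
  ultimately have lin: "L x = x * L 1" for x
    by (rule antimono_additive_linear)
  have "h r = r powr L 1" if "r > 0" for r
  proof -
    have "h r = exp (L (ln r))" using that pos by (simp add: L_def)
    also have "\<dots> = exp (ln r * L 1)" using lin[of "ln r"] by simp
    also have "\<dots> = r powr L 1" using that by (simp add: powr_def mult.commute)
    finally show ?thesis .
  qed
  then show ?thesis by blast
qed

text \<open>
  At a positive level, the superlevel set of an indicator is either the set itself or empty, so the
  distribution function only sees the measure of the set.
\<close>

lemma decreasing_rearrangement_indicator_cong:
  assumes "E \<subseteq> {0..}" "F \<subseteq> {0..}"
    and "emeasure lebesgue_halfline E = emeasure lebesgue_halfline F"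
  shows "decreasing_rearrangement (indicator E) t = decreasing_rearrangement (indicator F) t"
proof -
  have "{x \<in> {0..}. \<bar>indicator A x :: real\<bar> > s} = (if s < 1 then A else {})"
    if "A \<subseteq> {0..}" "s > 0" for A :: "real set" and s
    using that by (auto simp: indicator_def)
  then have "emeasure lebesgue_halfline {x \<in> {0..}. \<bar>indicator E x :: real\<bar> > s} =
      emeasure lebesgue_halfline {x \<in> {0..}. \<bar>indicator F x :: real\<bar> > s}" if "s > 0" for s
    using assms that by simp
  then show ?thesis
    unfolding decreasing_rearrangement_def by (metis (no_types, lifting))
qed

lemma dilation_indicator_interval:
  assumes "r > 0"
  shows "dilation r (indicator {0..t}) = indicator {0..t / r}"
  using assms by (auto simp: dilation_def indicator_def fun_eq_iff field_simps zero_le_mult_iff)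

lemma emeasure_halfline_interval:
  assumes "0 \<le> a" "a \<le> b"
  shows "emeasure lebesgue_halfline {a..b} = ennreal (b - a)"
    and "emeasure lebesgue_halfline {a<..b} = ennreal (b - a)"
proof -
  have "{a..b} \<subseteq> {0..}" "{a<..b} \<subseteq> {0..}"
    using assms by auto
  then show "emeasure lebesgue_halfline {a..b} = ennreal (b - a)"
    and "emeasure lebesgue_halfline {a<..b} = ennreal (b - a)"
    using assms by (simp_all add: emeasure_restrict_space)
qed

lemma interval_in_sets_halfline:
  assumes "0 \<le> a"
  shows "{a..b} \<in> sets lebesgue_halfline" and "{a<..b} \<in> sets lebesgue_halfline"
  using assms by (auto simp: sets_restrict_space_iff)

context ri_norm
begin

lemma indicator_interval_in_ri_space: "indicator {0..t} \<in> ri_space N"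
proof -
  have "emeasure lebesgue_halfline {0..t} < \<infinity>"
    by (cases "0 \<le> t") (auto simp: emeasure_halfline_interval)
  then show ?thesis
    unfolding ri_space_def
    by (intro CollectI conjI borel_measurable_indicator indicator_finite)
      (simp_all add: interval_in_sets_halfline)
qed

lemma norm_unit_interval:
  obtains c where "c > 0" "N (indicator {0..1}) = ennreal c"
proof -
  have "\<not> (AE x in lebesgue_halfline. (indicator {0..1} x :: real) = 0)"
  proof
    assume "AE x in lebesgue_halfline. (indicator {0..1} x :: real) = 0"
    then have "AE x in lebesgue_halfline. x \<notin> {0..1::real}"
      by eventually_elim (auto simp: indicator_def split: if_splits)
    then have "emeasure lebesgue_halfline {0..1::real} = 0"
      using AE_iff_null_sets[of "{0..1::real}" lebesgue_halfline]
        interval_in_sets_halfline(1)[of 0 1] by blast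
    then show False by (simp add: emeasure_halfline_interval)
  qed
  then have "N (indicator {0..1}) \<noteq> 0"
    using definite indicator_interval_in_ri_space[of 1] by (simp add: ri_space_def)
  moreover have "N (indicator {0..1}) < \<infinity>"
    using indicator_interval_in_ri_space[of 1] by (simp add: ri_space_def)
  ultimately show ?thesis
    by (cases "N (indicator {0..1})") (auto intro!: that simp: order_less_le)
qed

context
  fixes h :: "real \<Rightarrow> real"
  assumes h_pos: "\<And>r. r > 0 \<Longrightarrow> h r > 0"
    and hom: "h_homogeneous h N"
begin

lemma norm_dilated_interval:
  assumes "r > 0"
  shows "N (indicator {0..t / r}) = ennreal (h r) * N (indicator {0..t})"
  using hom assms indicator_interval_in_ri_space dilation_indicator_interval[of r t]
  unfolding h_homogeneous_def by metis

lemma homogeneity_multiplicative: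
  assumes "r > 0" "s > 0"
  shows "h (r * s) = h r * h s"
proof -
  obtain c where c: "c > 0" "N (indicator {0..1}) = ennreal c"
    by (rule norm_unit_interval)
  have "ennreal (h (r * s) * c) = N (indicator {0..1 / r / s})"
    using norm_dilated_interval[of "r * s" 1] assms c h_pos[of "r * s"]
    by (simp add: ennreal_mult)
  also have "\<dots> = ennreal (h s) * (ennreal (h r) * ennreal c)"
    using norm_dilated_interval[of s "1 / r"] norm_dilated_interval[of r 1] assms c by simp
  also have "\<dots> = ennreal (h s * (h r * c))"
    using assms c h_pos[of r] h_pos[of s] by (simp add: ennreal_mult)
  finally have "h (r * s) * c = h s * (h r * c)"
    using assms c h_pos[of r] h_pos[of s] h_pos[of "r * s"] by (subst (asm) ennreal_inj) auto
  then show ?thesis using c by simp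
qed

lemma homogeneity_antitone:
  assumes "0 < r" "r \<le> s"
  shows "h s \<le> h r"
proof -
  obtain c where c: "c > 0" "N (indicator {0..1}) = ennreal c"
    by (rule norm_unit_interval)
  have "1 / s \<le> 1 / r"
    using assms by (intro frac_le) auto
  then have "indicator {0..1 / s} x \<le> (indicator {0..1 / r} x :: real)" for x
    unfolding indicator_def by (cases "x \<le> 1 / s") auto
  then have "N (indicator {0..1 / s}) \<le> N (indicator {0..1 / r})"
    using indicator_interval_in_ri_space
    by (intro lattice AE_I2) (auto simp: ri_space_def)
  then have "ennreal (h s * c) \<le> ennreal (h r * c)"
    using norm_dilated_interval[of s 1] norm_dilated_interval[of r 1] assms c
      h_pos[of r] h_pos[of s] by (simp add: ennreal_mult)
  then show ?thesis
    using c assms h_pos[of r] by (simp add: ennreal_le_iff)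
qed

text \<open>
  Splitting \<open>{0..2}\<close> into two equimeasurable halves and applying the triangle inequality gives
  \<open>\<phi> 2 \<le> 2 * \<phi> 1\<close> for the fundamental function \<open>\<phi>\<close>, and \<open>\<phi> 2 = h (1 / 2) * \<phi> 1\<close>.
\<close>

lemma homogeneity_half_le: "h (1 / 2) \<le> 2"
proof -
  obtain c where c: "c > 0" "N (indicator {0..1}) = ennreal c"
    by (rule norm_unit_interval)
  have shift: "N (indicator {1<..2}) = N (indicator {0..1})"
    by (intro rearrangement_invariant allI impI decreasing_rearrangement_indicator_cong)
      (auto simp: emeasure_halfline_interval interval_in_sets_halfline
        intro!: borel_measurable_indicator)
  have split: "indicator {0..2} = (\<lambda>x::real. indicator {0..1} x + indicator {1<..2} x :: real)"
    by (auto simp: indicator_def fun_eq_iff)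
  have "ennreal (h (1 / 2) * c) = N (indicator {0..2})"
    using norm_dilated_interval[of "1 / 2" 1] c h_pos[of "1 / 2"] by (simp add: ennreal_mult)
  also have "\<dots> \<le> N (indicator {0..1}) + N (indicator {1<..2})"
    unfolding split
    by (intro subadditive borel_measurable_indicator) (simp_all add: interval_in_sets_halfline)
  also have "\<dots> = ennreal (2 * c)"
    using shift c by (simp add: ennreal_plus[symmetric] del: ennreal_plus)
  finally show ?thesis using c by (simp add: ennreal_le_iff)
qed

end

end

theorem theorem2p4:
  fixes h :: "real \<Rightarrow> real"
    and N :: "(real \<Rightarrow> real) \<Rightarrow> ennreal"
  assumes h_pos: "\<And>r. r > 0 \<Longrightarrow> h r > 0"
    and h_nonconstant: "\<not> h constant_on {0<..}"
    and ri: "ri_norm N"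
    and hom: "h_homogeneous h N"
  shows "\<exists>p::real. 1 \<le> p \<and> (\<forall>r>0. h r = r powr (- 1 / p))"
proof -
  have "\<exists>a. \<forall>r>0. h r = r powr a"
  proof (rule antitone_multiplicative_powr[of h])
    show "h r > 0" if "r > 0" for r
      using that by (rule h_pos)
    show "h (r * s) = h r * h s" if "r > 0" "s > 0" for r s
      using ri_norm.homogeneity_multiplicative[OF ri h_pos hom that] .
    show "h s \<le> h r" if "0 < r" "r \<le> s" for r s
      using ri_norm.homogeneity_antitone[OF ri h_pos hom that] .
  qed
  then obtain a where a: "\<And>r. r > 0 \<Longrightarrow> h r = r powr a"
    by blast
  have "a \<noteq> 0"
    using h_nonconstant a by (auto simp: constant_on_def)
  moreover have "a \<le> 0"
  proof -
    have "2 powr a \<le> (2::real) powr 0"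
      using ri_norm.homogeneity_antitone[OF ri h_pos hom, of 1 2] a by simp
    then show ?thesis by (simp only: powr_le_cancel_iff)
  qed
  ultimately have "a < 0" by simp
  have "2 powr (- a) \<le> (2::real) powr 1"
    using ri_norm.homogeneity_half_le[OF ri h_pos hom] a[of "1 / 2"]
    by (simp add: powr_divide powr_minus_divide)
  then have "- 1 \<le> a" by (simp only: powr_le_cancel_iff)
  with \<open>a < 0\<close> a show ?thesis
    by (intro exI[of _ "- 1 / a"]) (simp add: field_simps)
qed

end
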